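(* Let $(Q,+)$ be a group, $\varphi,\beta,\psi\in Aut(Q,+)$, $\delta\in S_Q$, and $c\in Q$. The linear quasigroup $(Q,\cdot)$ given by $x\cdot y=\varphi x+\beta y+c$ and the quasigroup $(Q,\circ)$ given by $x\circ y=\psi y+\delta x$ are orthogonal if and only if for every $b\in Q$ the mapping $(J_{\psi^{-1}b}\psi^{-1}\delta-\beta^{-1}\varphi)$, i.e. $x\mapsto J_{\psi^{-1}b}\psi^{-1}\delta x-\beta^{-1}\varphi x$, is a permutation of the set $Q$.
   Context: Groups are written additively but need not be commutative. $S_Q$ is the set of all permutations (bijections) of the set $Q$. Products of maps are compositions, $(\alpha\beta)x=\alpha(\beta x)$. For $t\in Q$, $J_t$ is the inner automorphism $J_tx=t+x-t$. Two quasigroups $(Q,\cdot)$ and $(Q,\circ)$ on the same set are orthogonal if for all $a,b\in Q$ the system $x\cdot y=a$, $x\circ y=b$ has a unique solution $(x,y)\in Q\times Q$. *)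

theory Defs
  imports Main
begin

text \<open>
  The class \<open>group_add\<close> is that of additively written groups that need not be commutative;
  there \<open>x - y\<close> means \<open>x + (- y)\<close>. The group on \<open>Q\<close> is an instance of it, so that \<open>Q\<close> is
  the whole type.
\<close>

definition group_aut :: "('a::group_add \<Rightarrow> 'a) \<Rightarrow> bool" where
  "group_aut f \<longleftrightarrow> bij f \<and> (\<forall>x y. f (x + y) = f x + f y)"

definition inner_aut :: "'a::group_add \<Rightarrow> 'a \<Rightarrow> 'a" where
  "inner_aut t x = t + x - t"

definition quasigroup :: "('a \<Rightarrow> 'a \<Rightarrow> 'a) \<Rightarrow> bool" where
  "quasigroup f \<longleftrightarrow> (\<forall>a b. (\<exists>!x. f a x = b) \<and> (\<exists>!y. f y a = b))"

text \<open>
  Orthogonality is a relation between quasigroups, so it includes that both operations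
  are quasigroups.
\<close>

definition orthogonal_quasigroups :: "('a \<Rightarrow> 'a \<Rightarrow> 'a) \<Rightarrow> ('a \<Rightarrow> 'a \<Rightarrow> 'a) \<Rightarrow> bool" where
  "orthogonal_quasigroups f g \<longleftrightarrow>
     quasigroup f \<and> quasigroup g \<and> (\<forall>a b. \<exists>!(x, y). f x y = a \<and> g x y = b)"

end

theory Submission
  imports Defs
begin

text \<open>
  The second equation determines \<open>y = t - \<psi>\<inverse>\<delta>x\<close>, where \<open>t = \<psi>\<inverse>b\<close>. Applying \<open>\<beta>\<inverse>\<close> to the first
  one then gives \<open>\<beta>\<inverse>\<phi>x + t - \<psi>\<inverse>\<delta>x = \<beta>\<inverse>(a - c)\<close>, which after negation and addition of \<open>t\<close> on the
  left says that the map in question takes \<open>x\<close> to \<open>t - \<beta>\<inverse>(a - c)\<close>. For fixed \<open>b\<close> the right-hand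
  side runs over the whole group as \<open>a\<close> does.
\<close>

lemma group_aut_bij: "group_aut f \<Longrightarrow> bij f"
  by (simp add: group_aut_def)

lemma group_aut_add: "group_aut f \<Longrightarrow> f (x + y) = f x + f y"
  by (simp add: group_aut_def)

lemma group_aut_diff:
  assumes "group_aut f"
  shows "f (x - y) = f x - f y"
  using group_aut_add[OF assms, of "x - y" y] by (simp add: eq_diff_eq)

lemma group_aut_inv:
  assumes "group_aut f"
  shows "group_aut (inv f)"
proof -
  have f: "bij f"
    using assms by (rule group_aut_bij)
  have "inv f (x + y) = inv f x + inv f y" for x y
    using f by (simp add: inv_f_eq bij_is_inj bij_is_surj surj_f_inv_f group_aut_add[OF assms])
  with f show ?thesis
    by (simp add: group_aut_def bij_imp_bij_inv)
qed

lemma bij_eq_iff_eq_inv: "bij f \<Longrightarrow> f x = y \<longleftrightarrow> x = inv f y"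
  by (metis bij_inv_eq_iff)

text \<open>Cancelling the other two terms and applying the inverse of a bijection solves the
  equation for either variable. Bijections are taken instead of automorphisms because \<delta> is
  merely a permutation.\<close>

lemma quasigroup_linear:
  fixes f g :: "'a::group_add \<Rightarrow> 'a"
  assumes "bij f" and "bij g"
  shows "quasigroup (\<lambda>x y. f x + g y + c)"
proof -
  \<comment> \<open>As the group may be noncommutative, \<open>f x\<close> has to be cancelled on
    the left, whereas \<open>eq_diff_eq\<close> moves terms on the right.\<close>
  have solve_left: "u + v = w \<longleftrightarrow> v = - u + w" for u v w :: 'a
    by auto
  have "f x + g y + c = a \<longleftrightarrow> g y = - f x + (a - c)" for x y a
    using solve_left[of "f x" "g y" "a - c"] by (simp only: eq_diff_eq)
  then have "f x + g y + c = a \<longleftrightarrow> y = inv g (- f x + (a - c))" for x y a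
    by (simp add: bij_eq_iff_eq_inv[OF assms(2)])
  then have "\<exists>!y. f x + g y + c = a" for x a
    by simp
  moreover have "f x + g y + c = a \<longleftrightarrow> x = inv f (a - c - g y)" for x y a
    by (simp only: bij_eq_iff_eq_inv[OF assms(1), symmetric] eq_diff_eq)
  then have "\<exists>!x. f x + g y + c = a" for y a
    by simp
  ultimately show ?thesis
    by (simp add: quasigroup_def)
qed

lemma quasigroup_swap: "quasigroup f \<Longrightarrow> quasigroup (\<lambda>x y. f y x)"
  by (auto simp: quasigroup_def)

text \<open>This form separates the unknowns: \<open>y\<close> is an explicit function of
  \<open>x\<close>, and the other condition involves \<open>x\<close> alone.\<close>

lemma system_iff:
  fixes \<phi> \<beta> \<psi> \<delta> :: "'q::group_add \<Rightarrow> 'q"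
  assumes \<beta>: "group_aut \<beta>" and \<psi>: "group_aut \<psi>"
  shows "\<phi> x + \<beta> y + c = a \<and> \<psi> y + \<delta> x = b \<longleftrightarrow>
    y = inv \<psi> b - inv \<psi> (\<delta> x) \<and>
    inner_aut (inv \<psi> b) (inv \<psi> (\<delta> x)) - inv \<beta> (\<phi> x) = inv \<psi> b - inv \<beta> (a - c)"
proof -
  define t d where "t = inv \<psi> b" and "d = inv \<psi> (\<delta> x)"
  have "\<psi> y + \<delta> x = b \<longleftrightarrow> \<psi> y = b - \<delta> x"
    by (simp add: eq_diff_eq)
  also have "\<dots> \<longleftrightarrow> y = t - d"
    using bij_eq_iff_eq_inv[OF group_aut_bij[OF \<psi>]] group_aut_diff[OF group_aut_inv[OF \<psi>]]
    by (simp add: t_def d_def)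
  finally have second: "\<psi> y + \<delta> x = b \<longleftrightarrow> y = t - d" .
  have "inv \<beta> (\<phi> x + \<beta> y) = inv \<beta> (\<phi> x) + y"
    using group_aut_add[OF group_aut_inv[OF \<beta>]] group_aut_bij[OF \<beta>] by (simp add: bij_is_inj)
  \<comment> \<open>Injectivity makes applying \<open>inv \<beta>\<close> to the first equation
    reversible.\<close>
  moreover have "inj (inv \<beta>)"
    using group_aut_bij[OF group_aut_inv[OF \<beta>]] by (rule bij_is_inj)
  ultimately have "\<phi> x + \<beta> y = a - c \<longleftrightarrow> inv \<beta> (\<phi> x) + y = inv \<beta> (a - c)"
    by (metis injD)
  then have first: "\<phi> x + \<beta> y + c = a \<longleftrightarrow> inv \<beta> (\<phi> x) + y = inv \<beta> (a - c)"
    by (simp add: eq_diff_eq)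
  \<comment> \<open>Here \<open>u\<close> stands for \<open>inv \<beta> (\<phi> x)\<close> and
    \<open>v\<close> for \<open>inv \<beta> (a - c)\<close>. Negation reverses the order of a sum,
    which puts \<open>d\<close> next to the added \<open>t\<close> and creates the conjugate
    \<open>t + d - t\<close>.\<close>
  have "u + (t - d) = v \<longleftrightarrow> t + d - t - u = t - v" for u v :: 'q
  proof -
    have "t + d - t - u = t - (u + (t - d))"
      by (simp only: diff_conv_add_uminus minus_add minus_minus add.assoc)
    then show ?thesis
      by (simp only: diff_conv_add_uminus add_left_cancel neg_equal_iff_equal)
  qed
  then show ?thesis
    unfolding first second inner_aut_def t_def[symmetric] d_def[symmetric] by auto
qed

theorem theorem24:
  fixes \<phi> \<beta> \<psi> \<delta> :: "'q::group_add \<Rightarrow> 'q" and c :: 'q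
  assumes "group_aut \<phi>" and "group_aut \<beta>" and "group_aut \<psi>" and "bij \<delta>"
  shows "orthogonal_quasigroups (\<lambda>x y. \<phi> x + \<beta> y + c) (\<lambda>x y. \<psi> y + \<delta> x)
    \<longleftrightarrow> (\<forall>b. bij (\<lambda>x. inner_aut (inv \<psi> b) (inv \<psi> (\<delta> x)) - inv \<beta> (\<phi> x)))"
proof -
  define M where "M b x = inner_aut (inv \<psi> b) (inv \<psi> (\<delta> x)) - inv \<beta> (\<phi> x)" for b x
  have linear: "quasigroup (\<lambda>x y. \<phi> x + \<beta> y + c)"
    using assms by (simp add: quasigroup_linear group_aut_bij)
  have swapped: "quasigroup (\<lambda>x y. \<psi> y + \<delta> x)"
    \<comment> \<open>The second operation is a linear form with constant 0 and its arguments
      exchanged.\<close>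
    using quasigroup_swap[OF quasigroup_linear[of \<psi> \<delta> 0]] assms by (simp add: group_aut_bij)
  \<comment> \<open>Since \<open>x\<close> determines \<open>y\<close>, unique pairs correspond to
    unique \<open>x\<close>.\<close>
  have first: "(\<exists>!(x, y). \<phi> x + \<beta> y + c = a \<and> \<psi> y + \<delta> x = b) \<longleftrightarrow>
      (\<exists>!x. M b x = inv \<psi> b - inv \<beta> (a - c))" for a b
    unfolding system_iff[OF assms(2,3)] M_def by (auto simp: Ex1_def)
  have second: "(\<forall>a. \<exists>!x. M b x = inv \<psi> b - inv \<beta> (a - c)) \<longleftrightarrow> bij (M b)" for b
  proof -
    \<comment> \<open>The preimage of \<open>z\<close> comes from solving
      \<open>inv \<psi> b - inv \<beta> (a - c) = z\<close> for \<open>a\<close>.\<close>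
    have "inv \<psi> b - inv \<beta> (\<beta> (- z + inv \<psi> b) + c - c) = z" for z
      using group_aut_bij[OF assms(2)]
      by (simp add: bij_is_inj diff_add_eq_diff_diff_swap)
    then have "surj (\<lambda>a. inv \<psi> b - inv \<beta> (a - c))"
      by (rule surjI)
    then have "(\<forall>z. \<exists>!x. M b x = z) \<longleftrightarrow>
        (\<forall>z \<in> range (\<lambda>a. inv \<psi> b - inv \<beta> (a - c)). \<exists>!x. M b x = z)"
      by simp
    then show ?thesis
      by (simp add: bij_iff)
  qed
  have "orthogonal_quasigroups (\<lambda>x y. \<phi> x + \<beta> y + c) (\<lambda>x y. \<psi> y + \<delta> x) \<longleftrightarrow>
      (\<forall>a b. \<exists>!x. M b x = inv \<psi> b - inv \<beta> (a - c))"
    by (simp only: orthogonal_quasigroups_def linear swapped first simp_thms)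
  also have "\<dots> \<longleftrightarrow> (\<forall>b a. \<exists>!x. M b x = inv \<psi> b - inv \<beta> (a - c))"
    by (rule all_comm)
  also have "\<dots> \<longleftrightarrow> (\<forall>b. bij (M b))"
    by (simp only: second)
  finally show ?thesis
    by (simp only: M_def[abs_def])
qed

end
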